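(* Let $n\ge 1$ and $0\le k\le \frac{n(n-1)}{2}$ be integers, and let $\mathcal{S}(k,n)=L(00\cdots 0,\,k,\,n,\,0)$ be the ordered list of sequences in $S(k,n)$ produced by the recursive procedure Gen1_Gray called with parameters $(k,n,0)$. Then any two consecutive sequences in the list $\mathcal{S}(k,n)$ are close.
   Context: A subexcedant sequence of length $n$ is a sequence $\boldsymbol{c}=c_1c_2\ldots c_n$ of integers with $0\le c_i\le i-1$ for all $i$; its weight is $\sum_{i=1}^n c_i$. $S(k,n)$ is the set of subexcedant sequences of length $n$ and weight $k$. Procedure Gen1_Gray. For a length-$n$ sequence $\boldsymbol{c}$, integers $k\ge 0$, $r$, and $d\in\{0,1\}$ (the direction), $L(\boldsymbol{c},k,r,d)$ denotes the ordered list output by the call Gen1_Gray$(k,r,d)$ when the current sequence is $\boldsymbol{c}$. Write $\boldsymbol{c}+x\varepsilon_i$ for the sequence obtained from $\boldsymbol{c}$ by adding $x$ to its $i$-th entry. The list is defined recursively: - If $k=0$, then $L(\boldsymbol{c},k,r,d)$ is the one-element list $(\boldsymbol{c})$. - If $k>0$, put $r'=r-1$ if $c_r=r-1$ and $r'=r$ otherwise; $\ell=\min\{s : \frac{s(s-1)}{2}\ge k\}$; $e=k-\frac{(\ell-1)(\ell-2)}{2}$. - If $d=0$, $L(\boldsymbol{c},k,r,0)$ is the concatenation, in this order, of $L(\boldsymbol{c}+e\varepsilon_\ell,\,k-e,\,\ell,\,0)$ and then, for $i=\ell+1,\ell+2,\ldots,r'$ (increasing), of $L(\boldsymbol{c}+\varepsilon_i,\,k-1,\,i,\,d_i)$,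 where $d_{\ell+1}=(r'-\ell)\bmod 2$ and the values $d_{\ell+1},d_{\ell+2},\ldots$ alternate between $0$ and $1$ (so $d_{r'}=1$ when $r'>\ell$). - If $d=1$, $L(\boldsymbol{c},k,r,1)$ is the concatenation, in this order, for $i=r',r'-1,\ldots,\ell+1$ (decreasing), of $L(\boldsymbol{c}+\varepsilon_i,\,k-1,\,i,\,d_i)$, where $d_{r'}=0$ and the values $d_{r'},d_{r'-1},\ldots$ alternate between $0$ and $1$, followed by $L(\boldsymbol{c}+e\varepsilon_\ell,\,k-e,\,\ell,\,1)$. Closeness. Let $\boldsymbol{s},\boldsymbol{t}\in S(k,n)$ be distinct sequences that differ in at most three adjacent positions (i.e. all positions where they differ lie among three consecutive positions), and let $p$ be the rightmost position where they differ (necessarily $p\ge 3$). Their difference is the triple $(a_1,a_2,a_3)=(s_{p-2}-t_{p-2},\,s_{p-1}-t_{p-1},\,s_p-t_p)$. Two sequences $\boldsymbol{s},\boldsymbol{t}\in S(k,n)$ are close if they differ in at most three adjacent positions and their difference satisfies $$(a_1,a_2,a_3)\in\{\pm(0,1,-1),\pm(0,2,-2),\pm(1,-2,1),\pm(1,-3,2),\pm(1,1,-2),\pm(1,0,-1)\},$$ where $-(a_1,a_2,a_3)=(-a_1,-a_2,-a_3)$. *)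

theory Defs
  imports Main
begin

text \<open>Sequences of length \<open>n\<close> are lists of integers. Positions are counted from 1, so the
  \<open>i\<close>-th entry (for \<open>i \<ge> 1\<close>) is the list element with index \<open>i - 1\<close>.\<close>

definition entry :: "int list \<Rightarrow> nat \<Rightarrow> int" where
  "entry c i = c ! (i - 1)"

definition add_entry :: "int list \<Rightarrow> int \<Rightarrow> nat \<Rightarrow> int list" where
  "add_entry c x i = c[i - 1 := entry c i + x]"

definition subexcedant :: "nat \<Rightarrow> int list \<Rightarrow> bool" where
  "subexcedant n c \<longleftrightarrow> length c = n \<and> (\<forall>i\<in>{1..n}. 0 \<le> entry c i \<and> entry c i \<le> int i - 1)"

definition weight :: "int list \<Rightarrow> int" where
  "weight c = sum_list c"

definition S :: "nat \<Rightarrow> nat \<Rightarrow> int list set" where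
  "S k n = {c. subexcedant n c \<and> weight c = int k}"

definition ell :: "nat \<Rightarrow> nat" where
  "ell k = (LEAST s. s * (s - 1) div 2 \<ge> k)"

definition excess :: "nat \<Rightarrow> nat" where
  "excess k = k - (ell k - 1) * (ell k - 2) div 2"

definition rprime :: "int list \<Rightarrow> nat \<Rightarrow> nat" where
  "rprime c r = (if entry c r = int r - 1 then r - 1 else r)"

lemma excess_pos:
  assumes "k > 0"
  shows "excess k > 0"
proof -
  have "Suc k * (Suc k - 1) div 2 \<ge> k"
    using assms by (cases k) auto
  then have ex: "ell k * (ell k - 1) div 2 \<ge> k"
    unfolding ell_def by (rule LeastI)
  then have "ell k > 0"
    using assms by (cases "ell k") auto
  then have "\<not> (ell k - 1) * (ell k - 1 - 1) div 2 \<ge> k"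
    unfolding ell_def by (intro not_less_Least) simp
  then show ?thesis
    by (simp add: excess_def numeral_2_eq_2)
qed

text \<open>In both loops the direction passed to the call for \<open>i\<close> is the prescribed direction of the
  first call in the loop plus the number of calls preceding it in the loop, taken modulo 2, which
  expresses that the directions alternate.\<close>

function gen1_gray :: "int list \<Rightarrow> nat \<Rightarrow> nat \<Rightarrow> nat \<Rightarrow> int list list" where
  "gen1_gray c k r d =
    (if k = 0 then [c]
     else
       let r' = rprime c r; l = ell k; e = excess k in
       if d = 0 then
         gen1_gray (add_entry c (int e) l) (k - e) l 0
         @ concat (map (\<lambda>i. gen1_gray (add_entry c 1 i) (k - 1) i (((r' - l) + (i - (l + 1))) mod 2))
             [l + 1..<r' + 1])
       else
         concat (map (\<lambda>i. gen1_gray (add_entry c 1 i) (k - 1) i ((r' - i) mod 2))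
             (rev [l + 1..<r' + 1]))
         @ gen1_gray (add_entry c (int e) l) (k - e) l 1)"
  by pat_completeness auto
termination
  by (relation "measure (\<lambda>(c, k, r, d). k)") (auto simp: excess_pos)

declare gen1_gray.simps [simp del]

definition gray_list :: "nat \<Rightarrow> nat \<Rightarrow> int list list" where
  "gray_list k n = gen1_gray (replicate n 0) k n 0"

definition diff_positions :: "int list \<Rightarrow> int list \<Rightarrow> nat set" where
  "diff_positions s t = {i \<in> {1..length s}. entry s i \<noteq> entry t i}"

definition difference :: "int list \<Rightarrow> int list \<Rightarrow> int \<times> int \<times> int" where
  "difference s t =
    (let p = Max (diff_positions s t) in
       (entry s (p - 2) - entry t (p - 2), entry s (p - 1) - entry t (p - 1), entry s p - entry t p))"

definition basic_differences :: "(int \<times> int \<times> int) set" where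
  "basic_differences =
    {(0, 1, -1), (0, 2, -2), (1, -2, 1), (1, -3, 2), (1, 1, -2), (1, 0, -1)}"

text \<open>Distinct elements of \<open>S k n\<close> always satisfy \<open>Max (diff_positions s t) \<ge> 3\<close>: the first
  entries are both 0 and the weights agree. So \<open>p - 2\<close> in \<open>difference\<close> is a genuine position.\<close>

definition close :: "nat \<Rightarrow> nat \<Rightarrow> int list \<Rightarrow> int list \<Rightarrow> bool" where
  "close k n s t \<longleftrightarrow>
    s \<in> S k n \<and> t \<in> S k n \<and> s \<noteq> t \<and>
    (\<exists>j. diff_positions s t \<subseteq> {j, j + 1, j + 2}) \<and>
    (case difference s t of (a1, a2, a3) \<Rightarrow>
       (a1, a2, a3) \<in> basic_differences \<or> (- a1, - a2, - a3) \<in> basic_differences)"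

end

theory Submission
  imports Defs
begin

text \<open>Since the directions alternate, the list for direction 1 is the reversal of the list for
  direction 0. The list for direction 0 starts with \<open>c + m\<close>, where \<open>m = (0, 1, \<dots>, \<ell> - 2, e, 0, \<dots>)\<close>
  is the packing of the weight \<open>k\<close> as far to the left as possible and does not depend on \<open>r\<close>.
  If \<open>r' > \<ell>\<close>, it ends with the first sequence of the block of \<open>r'\<close> for direction 0; otherwise
  it is a single sequence or it ends with the packing in which one unit has been moved from position
  \<open>\<ell> - 1\<close> to position \<open>\<ell>\<close>. Closeness at the junction of two blocks is then read off from
  these formulas, because lowering \<open>k\<close> by one lowers the packing by one at position \<open>\<ell>\<close>.\<close>

subsection \<open>Triangular numbers\<close>

text \<open>The largest weight \<open>0 + 1 + ... + (s - 1)\<close> of a subexcedant sequence of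
  length \<open>s\<close>.\<close>

definition tri :: "nat \<Rightarrow> nat" where
  "tri s = s * (s - 1) div 2"

lemma tri_0 [simp]: "tri 0 = 0"
  by (simp add: tri_def)

lemma tri_Suc [simp]: "tri (Suc s) = tri s + s"
proof (cases s)
  case (Suc q)
  have "Suc s * (Suc s - 1) = s * (s - 1) + s * 2"
    using Suc by simp
  then show ?thesis
    unfolding tri_def by (metis div_mult_self1 add.commute zero_neq_numeral)
qed (simp add: tri_def)

lemma tri_mono: "s \<le> t \<Longrightarrow> tri s \<le> tri t"
  by (rule lift_Suc_mono_le) auto

lemma tri_eq_pred: "s > 0 \<Longrightarrow> tri s = tri (s - 1) + (s - 1)"
  by (cases s) auto

text \<open>Galois connection: \<open>ell\<close> is the lower adjoint of the monotone function
  \<open>tri\<close>. Later comparisons with \<open>ell\<close> go through it instead of the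
  least-number definition.\<close>

lemma ell_le_iff: "ell k \<le> s \<longleftrightarrow> k \<le> tri s"
proof
  have "k \<le> tri (Suc k)"
    by simp
  then have "k \<le> tri (ell k)"
    unfolding ell_def tri_def by (rule LeastI)
  then show "ell k \<le> s \<Longrightarrow> k \<le> tri s"
    using tri_mono le_trans by blast
  show "k \<le> tri s \<Longrightarrow> ell k \<le> s"
    unfolding ell_def tri_def by (rule Least_le)
qed

lemma excess_eq: "excess k = k - tri (ell k - 1)"
  by (simp add: excess_def tri_def numeral_2_eq_2)

text \<open>The staircase \<open>0, 1, ..., ell k - 2\<close> uses up
  \<open>tri (ell k - 1)\<close>; by minimality of \<open>ell k\<close> the rest is positive and
  fits at position \<open>ell k\<close>.\<close>

lemma ell_bounds:
  assumes "k > 0"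
  shows "ell k \<ge> 2" "tri (ell k - 1) + excess k = k" "excess k > 0" "excess k \<le> ell k - 1"
proof -
  have "\<not> ell k \<le> 1"
    using assms unfolding ell_le_iff by (simp add: tri_def)
  then show l: "ell k \<ge> 2"
    by simp
  have "\<not> ell k \<le> ell k - 1" "ell k \<le> ell k"
    using l by auto
  then have "tri (ell k - 1) < k" "k \<le> tri (ell k)"
    by (simp_all only: ell_le_iff not_le)
  moreover have "tri (ell k) = tri (ell k - 1) + (ell k - 1)"
    using l by (intro tri_eq_pred) simp
  ultimately show "tri (ell k - 1) + excess k = k" "excess k > 0" "excess k \<le> ell k - 1"
    by (simp_all add: excess_eq)
qed

text \<open>Uniqueness of this decomposition: the bounds on \<open>e\<close> place \<open>k\<close>
  above \<open>tri (l - 1)\<close> and not above \<open>tri l\<close>.\<close>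

lemma ell_excess_eqI:
  assumes "tri (l - 1) + e = k" "0 < e" "e \<le> l - 1"
  shows "ell k = l" "excess k = e"
proof -
  have "ell k \<le> l"
    unfolding ell_le_iff using assms tri_eq_pred[of l] by linarith
  moreover have "\<not> ell k \<le> l - 1"
    unfolding ell_le_iff using assms by linarith
  ultimately show "ell k = l"
    by linarith
  then show "excess k = e"
    unfolding excess_eq using assms(1) by auto
qed

text \<open>The unit is taken from the excess. If the excess is 1, position \<open>ell k\<close>
  becomes empty and the staircase before it is left; \<open>ell k = 2\<close> would then give
  \<open>k = 1\<close>.\<close>

lemma ell_excess_pred:
  assumes "k > 1"
  shows "excess k > 1 \<Longrightarrow> ell (k - 1) = ell k \<and> excess (k - 1) = excess k - 1"
    and "excess k = 1 \<Longrightarrow> ell (k - 1) = ell k - 1 \<and> ell k \<ge> 3"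
proof -
  have k: "k > 0"
    using assms by simp
  note b = ell_bounds[OF k]
  show "ell (k - 1) = ell k \<and> excess (k - 1) = excess k - 1" if "excess k > 1"
  proof -
    have "tri (ell k - 1) + (excess k - 1) = k - 1" "0 < excess k - 1" "excess k - 1 \<le> ell k - 1"
      using b(2,4) that by linarith+
    from ell_excess_eqI[OF this] show ?thesis
      by simp
  qed
  show "ell (k - 1) = ell k - 1 \<and> ell k \<ge> 3" if "excess k = 1"
  proof -
    have "ell k \<noteq> 2"
      using that b(2) assms by (auto simp: tri_def)
    with b(1) have l3: "ell k \<ge> 3"
      by linarith
    have "tri (ell k - 1) = tri (ell k - 1 - 1) + (ell k - 1 - 1)"
      using l3 by (intro tri_eq_pred) linarith
    then have "tri (ell k - 1 - 1) + (ell k - 2) = k - 1"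
      using b(2) that by linarith
    then have "ell (k - 1) = ell k - 1"
      by (rule ell_excess_eqI) (use l3 in linarith)+
    with l3 show ?thesis
      by simp
  qed
qed

text \<open>Without its excess, \<open>k\<close> is \<open>tri (ell k - 1)\<close>, so the remaining
  packing has a maximal entry at its top position \<open>ell k - 1\<close>.\<close>

lemma ell_diff_excess:
  assumes "k > 0" "ell k \<ge> 3"
  shows "ell (k - excess k) = ell k - 1" "excess (k - excess k) = ell k - 2" "k - excess k > 0"
proof -
  have "tri (ell k - 1) = tri (ell k - 1 - 1) + (ell k - 1 - 1)"
    using assms(2) by (intro tri_eq_pred) linarith
  then have k: "tri (ell k - 1 - 1) + (ell k - 2) = k - excess k"
    using ell_bounds(2)[OF assms(1)] by linarith
  show "ell (k - excess k) = ell k - 1" "excess (k - excess k) = ell k - 2"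
    by (rule ell_excess_eqI[OF k]; use assms(2) in linarith)+
  show "k - excess k > 0"
    using k assms(2) by linarith
qed

lemma ell_eq_2: "k > 0 \<Longrightarrow> ell k = 2 \<Longrightarrow> k = 1 \<and> excess k = 1"
  using ell_bounds[of k] by (auto simp: tri_def)

subsection \<open>Leftmost packings\<close>

text \<open>The positions before \<open>j\<close> can hold \<open>tri (j - 1)\<close>. The weight
  beyond that goes to \<open>j\<close>, capped by \<open>j - 1\<close>; truncated subtraction gives
  0 beyond \<open>ell k\<close>.\<close>

definition packing :: "nat \<Rightarrow> nat \<Rightarrow> int" where
  "packing k j = int (min (j - 1) (k - tri (j - 1)))"

lemma packing_0 [simp]: "packing 0 j = 0"
  by (simp add: packing_def)

lemma packing_eq:
  assumes "k > 0"
  shows "packing k j =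
    (if j < ell k then int (j - 1) else if j = ell k then int (excess k) else 0)"
proof -
  note b = ell_bounds[OF assms]
  consider "j < ell k" | "j = ell k" | "j > ell k"
    by linarith
  then show ?thesis
  proof cases
    case 1
    have "tri (j - 1) + (j - 1) < k"
      using 1 assms ell_le_iff[of k j] tri_eq_pred[of j] by (cases j) auto
    with 1 show ?thesis
      by (simp add: packing_def)
  next
    case 2
    with b show ?thesis
      by (simp add: packing_def excess_eq)
  next
    case 3
    then have "ell k \<le> j - 1"
      by simp
    then have "k \<le> tri (j - 1)"
      by (simp only: ell_le_iff)
    with 3 show ?thesis
      by (simp add: packing_def)
  qed
qed

text \<open>The first recursive call only strips the top entry off the packing. For
  \<open>ell k = 2\<close> nothing remains, so that case lies outside \<open>packing_eq\<close> and
  is separate.\<close>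

lemma packing_diff_excess:
  assumes "k > 0"
  shows "packing (k - excess k) j = packing k j - (if j = ell k then int (excess k) else 0)"
proof (cases "ell k = 2")
  case True
  with assms ell_eq_2 have "k = 1" "excess k = 1"
    by blast+
  with True show ?thesis
    by (auto simp: packing_eq)
next
  case False
  with ell_bounds(1)[OF assms] have l: "ell k \<ge> 3"
    by simp
  show ?thesis
    using ell_diff_excess[OF assms l] l assms by (auto simp: packing_eq)
qed

lemma packing_pred:
  assumes "k > 0"
  shows "packing (k - 1) j = packing k j - (if j = ell k then 1 else 0)"
proof (cases "excess k = 1")
  case True
  with packing_diff_excess[OF assms, of j] show ?thesis
    by simp
next
  case False
  with ell_bounds[OF assms] have e: "excess k > 1" "k > 1"
    by linarith+
  with ell_excess_pred(1)[of k] show ?thesis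
    by (auto simp: packing_eq)
qed

subsection \<open>Shifted sequences\<close>

text \<open>Outputs of nested calls are all written as offsets from one base sequence, so that
  successive additions simply add up and outputs are compared by their offsets.\<close>

definition shift :: "int list \<Rightarrow> (nat \<Rightarrow> int) \<Rightarrow> int list" where
  "shift c f = map (\<lambda>j. entry c j + f j) [1..<Suc (length c)]"

lemma length_shift [simp]: "length (shift c f) = length c"
  by (simp add: shift_def del: upt_Suc)

lemma entry_shift:
  assumes "1 \<le> j" "j \<le> length c"
  shows "entry (shift c f) j = entry c j + f j"
proof -
  have "j - 1 < length c" "Suc (j - 1) = j"
    using assms by auto
  then show ?thesis
    unfolding entry_def[of "shift c f"] unfolding shift_def by (simp del: upt_Suc)
qed

lemma length_add_entry [simp]: "length (add_entry c x i) = length c"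
  by (simp add: add_entry_def)

lemma entry_add_entry:
  assumes "1 \<le> i" "1 \<le> j" "j \<le> length c"
  shows "entry (add_entry c x i) j = entry c j + (if j = i then x else 0)"
  using assms by (auto simp: entry_def add_entry_def nth_list_update)

lemma shift_add_entry:
  assumes "1 \<le> i"
  shows "shift (add_entry c x i) f = shift c (\<lambda>j. f j + (if j = i then x else 0))"
  using assms by (auto simp: shift_def entry_add_entry simp del: upt_Suc)

lemma shift_0 [simp]: "shift c (\<lambda>j. 0) = c"
  by (rule nth_equalityI) (auto simp: shift_def entry_def simp del: upt_Suc)

lemma weight_add_entry:
  assumes "1 \<le> i" "i \<le> length c"
  shows "weight (add_entry c x i) = weight c + x"
proof -
  have "sum_list (ys[m := ys ! m + x]) = sum_list ys + x" if "m < length ys" for m and ys :: "int list"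
    using that by (induction ys arbitrary: m) (auto simp: nth_Cons' split: nat.splits)
  with assms show ?thesis
    by (simp add: weight_def add_entry_def entry_def)
qed

text \<open>The base \<open>c\<close> cancels, so closeness reduces to comparing the offsets at
  three positions.\<close>

lemma close_shift:
  assumes mem: "shift c f \<in> S k n" "shift c g \<in> S k n"
    and p: "3 \<le> p" "p \<le> length c"
    and eq: "\<And>j. j \<notin> {p - 2, p - 1, p} \<Longrightarrow> f j = g j"
    and a: "f (p - 2) - g (p - 2) = a1" "f (p - 1) - g (p - 1) = a2" "f p - g p = a3"
    and basic: "(a1, a2, a3) \<in> basic_differences \<or> (- a1, - a2, - a3) \<in> basic_differences"
  shows "close k n (shift c f) (shift c g)"
proof -
  let ?D = "diff_positions (shift c f) (shift c g)"
  have D: "?D = {i \<in> {1..length c}. f i \<noteq> g i}"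
    by (auto simp: diff_positions_def entry_shift)
  \<comment> \<open>Every basic difference ends in a nonzero component, so \<open>p\<close> really
    is the rightmost differing position.\<close>
  have "a3 \<noteq> 0"
    using basic by (auto simp: basic_differences_def)
  with a(3) p have "p \<in> ?D"
    unfolding D by auto
  have sub: "?D \<subseteq> {p - 2, p - 1, p}"
    unfolding D using eq by blast
  have "Max ?D = p"
    using \<open>p \<in> ?D\<close> sub by (intro Max_eqI) (auto intro: finite_subset)
  then have "difference (shift c f) (shift c g) = (a1, a2, a3)"
    using p a by (simp add: difference_def entry_shift)
  moreover have "shift c f \<noteq> shift c g"
    using \<open>p \<in> ?D\<close> by (auto simp: diff_positions_def)
  moreover have "?D \<subseteq> {p - 2, p - 2 + 1, p - 2 + 2}"
    using sub p by auto
  ultimately show ?thesis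
    using mem basic unfolding close_def by auto
qed

lemma close_sym: "close k n s t \<Longrightarrow> close k n t s"
proof -
  assume c: "close k n s t"
  \<comment> \<open>\<open>diff_positions\<close> ranges over the length of its first argument, so
    its symmetry rests on equal lengths.\<close>
  then have "length s = length t"
    by (auto simp: close_def S_def subexcedant_def)
  then have d: "diff_positions t s = diff_positions s t"
    unfolding diff_positions_def by auto
  show ?thesis
    using c unfolding close_def difference_def d by (auto simp: Let_def)
qed

subsection \<open>Structure of the generated lists\<close>

lemma gen1_gray_0 [simp]: "gen1_gray c 0 r d = [c]"
  by (simp add: gen1_gray.simps)

text \<open>The direction is counted from the end \<open>rprime c r\<close> of the loop, to be
  matched with the count \<open>rprime c r - i\<close> used in direction 1.\<close>

lemma gen1_gray_unfold_0:
  assumes "k > 0"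
  shows "gen1_gray c k r 0 =
    gen1_gray (add_entry c (int (excess k)) (ell k)) (k - excess k) (ell k) 0 @
    concat (map (\<lambda>i. gen1_gray (add_entry c 1 i) (k - 1) i (Suc (rprime c r - i) mod 2))
      [Suc (ell k)..<Suc (rprime c r)])"
proof -
  have "gen1_gray c k r 0 =
      gen1_gray (add_entry c (int (excess k)) (ell k)) (k - excess k) (ell k) 0 @
      concat (map (\<lambda>i. gen1_gray (add_entry c 1 i) (k - 1) i
        ((rprime c r - ell k + (i - (ell k + 1))) mod 2)) [ell k + 1..<rprime c r + 1])"
    using assms by (simp add: gen1_gray.simps[of c k r 0] Let_def)
  also have "map (\<lambda>i. gen1_gray (add_entry c 1 i) (k - 1) i
      ((rprime c r - ell k + (i - (ell k + 1))) mod 2)) [ell k + 1..<rprime c r + 1]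
    = map (\<lambda>i. gen1_gray (add_entry c 1 i) (k - 1) i (Suc (rprime c r - i) mod 2))
      [ell k + 1..<rprime c r + 1]"
  proof (rule map_cong[OF refl])
    fix i assume "i \<in> set [ell k + 1..<rprime c r + 1]"
    \<comment> \<open>Both counts differ by an even number, hence give the same direction.\<close>
    then have "rprime c r - ell k + (i - (ell k + 1)) =
        Suc (rprime c r - i) + 2 * (i - (ell k + 1))"
      by (auto simp del: upt_Suc)
    then have "(rprime c r - ell k + (i - (ell k + 1))) mod 2 = Suc (rprime c r - i) mod 2"
      by presburger
    then show "gen1_gray (add_entry c 1 i) (k - 1) i
        ((rprime c r - ell k + (i - (ell k + 1))) mod 2) =
        gen1_gray (add_entry c 1 i) (k - 1) i (Suc (rprime c r - i) mod 2)"
      by simp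
  qed
  finally show ?thesis
    by simp
qed

lemma gen1_gray_unfold_1:
  assumes "k > 0"
  shows "gen1_gray c k r 1 =
    concat (map (\<lambda>i. gen1_gray (add_entry c 1 i) (k - 1) i ((rprime c r - i) mod 2))
      (rev [Suc (ell k)..<Suc (rprime c r)])) @
    gen1_gray (add_entry c (int (excess k)) (ell k)) (k - excess k) (ell k) 1"
  using assms by (simp add: gen1_gray.simps[of c k r 1] gen1_gray.simps[of c k r "Suc 0"] Let_def)

text \<open>Treats the first call as the member \<open>i = ell k\<close> of the loop, so that a list
  of direction 0 is one concatenation over consecutive indices.\<close>

definition block :: "int list \<Rightarrow> nat \<Rightarrow> nat \<Rightarrow> nat \<Rightarrow> int list list" where
  "block c k r i =
    (if i = ell k then gen1_gray (add_entry c (int (excess k)) i) (k - excess k) i 0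
     else gen1_gray (add_entry c 1 i) (k - 1) i (Suc (rprime c r - i) mod 2))"

lemma gen1_gray_direction_0:
  assumes "k > 0" "ell k \<le> rprime c r"
  shows "gen1_gray c k r 0 = concat (map (block c k r) [ell k..<Suc (rprime c r)])"
proof -
  have "[ell k..<Suc (rprime c r)] = ell k # [Suc (ell k)..<Suc (rprime c r)]"
    using assms(2) by (intro upt_conv_Cons) simp
  moreover have "map (block c k r) [Suc (ell k)..<Suc (rprime c r)] =
      map (\<lambda>i. gen1_gray (add_entry c 1 i) (k - 1) i (Suc (rprime c r - i) mod 2))
      [Suc (ell k)..<Suc (rprime c r)]"
    by (rule map_cong[OF refl]) (auto simp: block_def simp del: upt_Suc)
  ultimately show ?thesis
    unfolding gen1_gray_unfold_0[OF assms(1)]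
    by (simp only: list.map concat.simps block_def[of c k r "ell k"] simp_thms if_True)
qed

text \<open>The two directions run through the same calls in opposite order, each with the opposite
  direction; by induction every sublist is reversed as well.\<close>

lemma gen1_gray_direction_1: "gen1_gray c k r 1 = rev (gen1_gray c k r 0)"
proof (induction k arbitrary: c r rule: less_induct)
  case (less k)
  show ?case
  proof (cases "k = 0")
    case False
    then have k: "k > 0"
      by simp
    have main: "gen1_gray c' (k - excess k) (ell k) 1 =
        rev (gen1_gray c' (k - excess k) (ell k) 0)" for c'
      using k excess_pos[OF k] by (intro less.IH) simp
    have flip: "rev (gen1_gray c' (k - 1) i (Suc m mod 2)) =
        gen1_gray c' (k - 1) i (m mod 2)" for c' i m
    proof -
      have "gen1_gray c' (k - 1) i 1 = rev (gen1_gray c' (k - 1) i 0)"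
        using k by (intro less.IH) simp
      moreover have "m mod 2 = 0 \<and> Suc m mod 2 = 1 \<or> m mod 2 = 1 \<and> Suc m mod 2 = 0"
        by presburger
      ultimately show ?thesis
        by (elim disjE conjE) (simp_all only: rev_rev_ident)
    qed
    show ?thesis
      unfolding gen1_gray_unfold_0[OF k] gen1_gray_unfold_1[OF k] main
      by (simp only: rev_append rev_concat rev_map map_map comp_def flip)
  qed simp
qed

section \<open>Invariant of the recursive calls\<close>

text \<open>Since the entries before \<open>r\<close> vanish, the last condition says that the
  weight still to be placed fits into the first \<open>r\<close> positions.\<close>

definition admissible :: "nat \<Rightarrow> int list \<Rightarrow> nat \<Rightarrow> nat \<Rightarrow> bool" where
  "admissible n c k r \<longleftrightarrow> subexcedant n c \<and> 1 \<le> r \<and> r \<le> n \<and>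
    (\<forall>j. 1 \<le> j \<longrightarrow> j < r \<longrightarrow> entry c j = 0) \<and> int k + entry c r \<le> int (tri r)"

text \<open>If position \<open>r\<close> is full, removing its entry \<open>r - 1\<close> from the
  bound \<open>tri r\<close> leaves \<open>k <= tri (r - 1)\<close>; otherwise
  \<open>k <= tri r\<close> suffices.\<close>

lemma admissible_ell_le_rprime:
  assumes "admissible n c k r" "k > 0"
  shows "ell k \<le> rprime c r" "rprime c r \<le> r"
proof -
  have c: "0 \<le> entry c r" "int k + entry c r \<le> int (tri r)" "1 \<le> r"
    using assms(1) by (auto simp: admissible_def subexcedant_def)
  show "ell k \<le> rprime c r"
    unfolding ell_le_iff rprime_def using c tri_eq_pred[of r] by auto
  show "rprime c r \<le> r"
    by (simp add: rprime_def)
qed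

text \<open>For \<open>ell k = r\<close> the second bound is the invariant; for
  \<open>ell k < r\<close> the entry is 0. Subtracting \<open>tri (ell k - 1)\<close> yields the
  first bound.\<close>

lemma admissible_entry_ell:
  assumes "admissible n c k r" "k > 0"
  shows "entry c (ell k) + int (excess k) \<le> int (ell k) - 1"
    and "int k + entry c (ell k) \<le> int (tri (ell k))"
proof -
  note l = admissible_ell_le_rprime[OF assms] and b = ell_bounds[OF assms(2)]
  show *: "int k + entry c (ell k) \<le> int (tri (ell k))"
  proof (cases "ell k = r")
    case False
    with l b assms have "entry c (ell k) = 0"
      by (simp add: admissible_def)
    then show ?thesis
      using ell_le_iff[of k "ell k"] by simp
  qed (use assms in \<open>simp add: admissible_def\<close>)
  have "int k = int (tri (ell k - 1)) + int (excess k)"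
    using b(2) by linarith
  with * show "entry c (ell k) + int (excess k) \<le> int (ell k) - 1"
    using tri_eq_pred[of "ell k"] b(1) by (simp add: of_nat_diff)
qed

text \<open>Common form of both kinds of calls: \<open>x\<close> units pass from \<open>k\<close> to
  entry \<open>i\<close>, which leaves \<open>k\<close> plus that entry unchanged.\<close>

lemma admissible_add_entry:
  assumes "admissible n c k r" "1 \<le> i" "i \<le> r" "0 \<le> x" "x \<le> int k"
    and "entry c i + x \<le> int i - 1" "int k + entry c i \<le> int (tri i)"
  shows "admissible n (add_entry c x i) (k - nat x) i"
proof -
  have "length c = n" "r \<le> n"
    using assms(1) by (auto simp: admissible_def subexcedant_def)
  then show ?thesis
    using assms unfolding admissible_def subexcedant_def
    by (auto simp: entry_add_entry)
qed

lemma admissible_ell: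
  assumes "admissible n c k r" "k > 0"
  shows "admissible n (add_entry c (int (excess k)) (ell k)) (k - excess k) (ell k)"
  using admissible_add_entry[OF assms(1), of "ell k" "int (excess k)"]
    admissible_entry_ell[OF assms] admissible_ell_le_rprime[OF assms] ell_bounds[OF assms(2)]
  by simp

lemma admissible_above_ell:
  assumes "admissible n c k r" "k > 0" "ell k < i" "i \<le> rprime c r"
  shows "admissible n (add_entry c 1 i) (k - 1) i"
proof -
  have b: "ell k \<ge> 2" and r: "rprime c r \<le> r"
    using ell_bounds[OF assms(2)] admissible_ell_le_rprime[OF assms(1,2)] by auto
  have "entry c i + 1 \<le> int i - 1 \<and> int k + entry c i \<le> int (tri i)"
  proof (cases "i = r")
    case True
    \<comment> \<open>\<open>i = r\<close> forces \<open>rprime c r = r\<close>, so position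
      \<open>r\<close> still has room for a unit.\<close>
    with assms(4) b have "entry c r \<noteq> int r - 1"
      using assms(3) by (auto simp: rprime_def split: if_splits)
    moreover have "entry c r \<le> int r - 1"
      using assms(1) by (simp add: admissible_def subexcedant_def)
    ultimately show ?thesis
      using assms(1) True by (simp add: admissible_def)
  next
    case False
    then have "entry c i = 0"
      using assms r b by (simp add: admissible_def)
    then show ?thesis
      using assms(3) b ell_le_iff[of k i] by simp
  qed
  then show ?thesis
    using admissible_add_entry[OF assms(1), of i 1] assms b r by simp
qed

lemma set_gen1_gray_mod_2: "set (gen1_gray c k r (m mod 2)) = set (gen1_gray c k r 0)"
proof -
  have "m mod 2 = 0 \<or> m mod 2 = 1"
    by auto
  then show ?thesis
    by (elim disjE) (simp_all only: gen1_gray_direction_1 set_rev)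
qed

text \<open>\<open>w\<close> is the final weight: each call adds to the sequence what it takes from
  \<open>k\<close>, so the sum is constant along the recursion.\<close>

lemma gen1_gray_subset:
  assumes "admissible n c k r" "weight c + int k = int w"
  shows "set (gen1_gray c k r 0) \<subseteq> S w n"
  using assms
proof (induction k arbitrary: c r rule: less_induct)
  case (less k)
  show ?case
  proof (cases "k = 0")
    case True
    with less.prems show ?thesis
      by (simp add: S_def admissible_def)
  next
    case False
    then have k: "k > 0"
      by simp
    note adm = less.prems(1) and l = admissible_ell_le_rprime[OF less.prems(1) k]
      and b = ell_bounds[OF k]
    have n: "length c = n" "r \<le> n"
      using adm by (auto simp: admissible_def subexcedant_def)
    have "set (block c k r i) \<subseteq> S w n" if i: "ell k \<le> i" "i \<le> rprime c r" for i
    proof (cases "i = ell k")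
      case True
      have "set (gen1_gray (add_entry c (int (excess k)) i) (k - excess k) i 0) \<subseteq> S w n"
        using less.prems k b l n admissible_ell[OF adm k] True
        by (intro less.IH) (auto simp: weight_add_entry)
      with True show ?thesis
        by (simp add: block_def)
    next
      case False
      have "set (gen1_gray (add_entry c 1 i) (k - 1) i 0) \<subseteq> S w n"
        using less.prems k b l n admissible_above_ell[OF adm k, of i] False i
        by (intro less.IH) (auto simp: weight_add_entry)
      with False show ?thesis
        by (simp add: block_def set_gen1_gray_mod_2)
    qed
    then show ?thesis
      unfolding gen1_gray_direction_0[OF k l(1)] by (simp add: UN_subset_iff del: upt_Suc)
  qed
qed

section \<open>First and last sequences\<close>

text \<open>The first call is followed repeatedly; each time it places the top entry of the packing
  that remains.\<close>

lemma gen1_gray_hd: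
  assumes "admissible n c k r"
  shows "gen1_gray c k r 0 \<noteq> [] \<and> hd (gen1_gray c k r 0) = shift c (packing k)"
  using assms
proof (induction k arbitrary: c r rule: less_induct)
  case (less k)
  show ?case
  proof (cases "k = 0")
    case True
    then show ?thesis
      using shift_0[of c] by (simp add: packing_0[abs_def] del: shift_0)
  next
    case False
    then have k: "k > 0"
      by simp
    let ?g = "gen1_gray (add_entry c (int (excess k)) (ell k)) (k - excess k) (ell k) 0"
    have "?g \<noteq> [] \<and>
        hd ?g = shift (add_entry c (int (excess k)) (ell k)) (packing (k - excess k))"
      using k ell_bounds[OF k] admissible_ell[OF less.prems k] by (intro less.IH) auto
    then have "?g \<noteq> []" "hd ?g = shift c (packing k)"
      using ell_bounds(1)[OF k]
      by (simp_all add: shift_add_entry packing_diff_excess[OF k])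
    then show ?thesis
      by (simp add: gen1_gray_unfold_0[OF k] del: upt_Suc)
  qed
qed

lemmas gen1_gray_nonempty = gen1_gray_hd[THEN conjunct1]

lemma block_nonempty:
  assumes "admissible n c k r" "k > 0" "ell k \<le> i" "i \<le> rprime c r"
  shows "block c k r i \<noteq> []"
proof (cases "i = ell k")
  case True
  with gen1_gray_nonempty[OF admissible_ell[OF assms(1,2)]] show ?thesis
    by (simp add: block_def)
next
  case False
  with assms gen1_gray_nonempty[OF admissible_above_ell[OF assms(1,2)]]
  have "set (gen1_gray (add_entry c 1 i) (k - 1) i (Suc (rprime c r - i) mod 2)) \<noteq> {}"
    by (simp add: set_gen1_gray_mod_2)
  with False show ?thesis
    by (simp add: block_def)
qed

lemma gen1_gray_last_block:
  assumes "admissible n c k r" "k > 0"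
  shows "last (gen1_gray c k r 0) = last (block c k r (rprime c r))"
  using block_nonempty[OF assms _ order_refl] admissible_ell_le_rprime(1)[OF assms]
  by (simp add: gen1_gray_direction_0[OF assms(2)])

text \<open>The block of \<open>rprime c r\<close> has direction 1 and is therefore a reversed list,
  whose last sequence is the first one of direction 0.\<close>

lemma gen1_gray_last_above:
  assumes "admissible n c k r" "k > 0" "ell k < rprime c r"
  shows "last (gen1_gray c k r 0) =
    shift c (\<lambda>j. packing (k - 1) j + (if j = rprime c r then 1 else 0))"
  using assms gen1_gray_hd[OF admissible_above_ell[OF assms order_refl]]
    ell_bounds[OF assms(2)]
  by (simp add: gen1_gray_last_block block_def gen1_gray_direction_1[unfolded One_nat_def]
      last_rev shift_add_entry)

text \<open>The case distinction is whether the excess fills position \<open>ell k\<close>. If so,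
  the staircase below is forced; if not, the last sequence moves a unit from
  \<open>ell k - 1\<close> to \<open>ell k\<close>.\<close>

lemma last_block_ell:
  assumes "admissible n c k r" "k > 0"
  shows "last (block c k r (ell k)) =
    shift c (\<lambda>j. packing k j +
      (if entry c (ell k) + int (excess k) = int (ell k) - 1 then 0
       else (if j = ell k then 1 else 0) - (if j = ell k - 1 then 1 else 0)))"
  using assms
proof (induction k arbitrary: c r rule: less_induct)
  case (less k)
  note adm = less.prems(1) and k = less.prems(2)
  note l = admissible_ell_le_rprime[OF adm k] and b = ell_bounds[OF k]
  define c' where "c' = add_entry c (int (excess k)) (ell k)"
  have n: "length c = n" "r \<le> n"
    using adm by (auto simp: admissible_def subexcedant_def)
  have c': "entry c' (ell k) = entry c (ell k) + int (excess k)"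
    unfolding c'_def using b l n by (simp add: entry_add_entry)
  have last: "last (block c k r (ell k)) = last (gen1_gray c' (k - excess k) (ell k) 0)"
    by (simp add: block_def c'_def)
  have shift_c': "shift c' f = shift c (\<lambda>j. f j + (if j = ell k then int (excess k) else 0))" for f
    unfolding c'_def using b by (simp add: shift_add_entry)
  have adm': "admissible n c' (k - excess k) (ell k)"
    unfolding c'_def by (rule admissible_ell[OF adm k])
  show ?case
  proof (cases "ell k = 2")
    case True
    with k ell_eq_2 have "k = 1" "excess k = 1"
      by blast+
    \<comment> \<open>Position 2 holds at most 1 and receives the excess 1, so this is the filled
      case.\<close>
    moreover have "entry c (ell k) = 0"
      using admissible_entry_ell(1)[OF adm k] adm b l n True \<open>excess k = 1\<close>
      by (auto simp: admissible_def subexcedant_def dest: bspec[of _ _ 2])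
    moreover have "packing 1 j = (if j = 2 then 1 else 0)" for j
      using packing_eq[of 1 j] True \<open>k = 1\<close> \<open>excess k = 1\<close> by auto
    moreover have "c' = shift c (\<lambda>j. if j = ell k then int (excess k) else 0)"
      using shift_c'[of "\<lambda>_. 0"] by simp
    ultimately show ?thesis
      using True last by (simp cong: if_cong)
  next
    case False
    with b have l3: "ell k \<ge> 3"
      by simp
    note k' = ell_diff_excess[OF k l3]
    show ?thesis
    proof (cases "entry c (ell k) + int (excess k) = int (ell k) - 1")
      case True
      then have r': "rprime c' (ell k) = ell k - 1"
        using c' by (simp add: rprime_def)
      have "entry c' (ell k - 1) = 0"
        using adm' l3 by (simp add: admissible_def)
      \<comment> \<open>The remaining staircase fills position \<open>ell k - 1\<close> in turn, so
        the filled case of the induction hypothesis applies.\<close>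
      then have full: "entry c' (ell (k - excess k)) + int (excess (k - excess k)) =
          int (ell (k - excess k)) - 1"
        unfolding k'(1,2) using l3 by linarith
      have "last (gen1_gray c' (k - excess k) (ell k) 0) =
          last (block c' (k - excess k) (ell k) (ell (k - excess k)))"
        unfolding gen1_gray_last_block[OF adm' k'(3)] r' k'(1) ..
      also have "\<dots> = shift c' (packing (k - excess k))"
        using less.IH[OF _ adm' k'(3)] b(3) k unfolding if_P[OF full] by simp
      finally show ?thesis
        unfolding last if_P[OF True] shift_c' packing_diff_excess[OF k] by simp
    next
      case False
      then have r': "rprime c' (ell k) = ell k"
        using c' by (simp add: rprime_def)
      \<comment> \<open>There is room at \<open>ell k\<close>, which lies above
        \<open>ell (k - excess k) = ell k - 1\<close>, so the inner loop is nonempty and its last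
        block adds a unit at \<open>ell k\<close>.\<close>
      have "last (gen1_gray c' (k - excess k) (ell k) 0) =
          shift c' (\<lambda>j. packing (k - excess k - 1) j + (if j = ell k then 1 else 0))"
        using gen1_gray_last_above[OF adm'] k' r' b by simp
      then have "last (block c k r (ell k)) = shift c (\<lambda>j. packing k j
          - (if j = ell k then int (excess k) else 0) - (if j = ell k - 1 then 1 else 0)
          + (if j = ell k then 1 else 0) + (if j = ell k then int (excess k) else 0))"
        unfolding last shift_c' packing_pred[OF k'(3)] packing_diff_excess[OF k] k'(1) .
      also have "\<dots> = shift c (\<lambda>j. packing k j +
          ((if j = ell k then 1 else 0) - (if j = ell k - 1 then 1 else 0)))"
        by (rule arg_cong[of _ _ "shift c"]) auto
      finally show ?thesis
        unfolding if_not_P[OF False] .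
    qed
  qed
qed

lemma block_above:
  assumes "ell k < i"
  shows "block c k r i = (if even (rprime c r - i)
    then rev (gen1_gray (add_entry c 1 i) (k - 1) i 0) else gen1_gray (add_entry c 1 i) (k - 1) i 0)"
proof -
  have "even m \<and> Suc m mod 2 = 1 \<or> odd m \<and> Suc m mod 2 = 0" for m
    by presburger
  then show ?thesis
    using assms gen1_gray_direction_1[of "add_entry c 1 i" "k - 1" i]
    unfolding block_def by (metis less_irrefl)
qed

subsection \<open>Closeness at the junctions\<close>

text \<open>The entry at \<open>i < r\<close> was 0 and is now 1, which is less than
  \<open>i - 1\<close> unless \<open>i = 2\<close>; but \<open>i\<close> exceeds
  \<open>ell k >= 2\<close>.\<close>

lemma rprime_above_ell:
  assumes "admissible n c k r" "k > 0" "ell k < i" "i < rprime c r"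
  shows "rprime (add_entry c 1 i) i = i"
proof -
  have i: "1 \<le> i" "i < r" "3 \<le> i"
    using assms ell_bounds(1)[OF assms(2)] admissible_ell_le_rprime(2)[OF assms(1,2)] by auto
  then have c: "entry c i = 0"
    using assms(1) by (simp add: admissible_def)
  have "length c = n" "r \<le> n"
    using assms(1) by (auto simp: admissible_def subexcedant_def)
  with i c show ?thesis
    by (simp add: rprime_def entry_add_entry)
qed

lemma rprime_cases: "rprime c i = i \<or> rprime c i = i - 1"
  by (simp add: rprime_def)

text \<open>The outer call puts a unit at \<open>i\<close>, the last inner call one at its own
  \<open>rprime\<close>, and the packing of \<open>k - 2\<close> remains.\<close>

lemma gen1_gray_above_last:
  assumes "admissible n c k r" "k > 1" "ell k < i" "i \<le> rprime c r"
    and "ell (k - 1) < rprime (add_entry c 1 i) i"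
  shows "last (gen1_gray (add_entry c 1 i) (k - 1) i 0) =
    shift c (\<lambda>j. packing (k - 1) j - (if j = ell (k - 1) then 1 else 0)
      + (if j = i then 1 else 0) + (if j = rprime (add_entry c 1 i) i then 1 else 0))"
proof -
  have k: "k > 0" "k - 1 > 0"
    using assms(2) by auto
  have "last (gen1_gray (add_entry c 1 i) (k - 1) i 0) = shift (add_entry c 1 i)
      (\<lambda>j. packing (k - 1 - 1) j + (if j = rprime (add_entry c 1 i) i then 1 else 0))"
    by (rule gen1_gray_last_above[OF admissible_above_ell[OF assms(1) k(1) assms(3,4)] k(2) assms(5)])
  then show ?thesis
    using assms(3) unfolding packing_pred[OF k(2)]
    by (simp add: shift_add_entry algebra_simps cong: if_cong)
qed

lemma ell_pred_le: "ell (k - 1) \<le> ell k"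
  using ell_le_iff[of "k - 1" "ell k"] ell_le_iff[of k "ell k"] by simp

text \<open>Adjacent blocks have opposite directions, so either the two first or the two last
  sequences of the lists of direction 0 meet. First sequences differ by a unit moved from
  \<open>i\<close> to \<open>Suc i\<close>.\<close>

lemma close_above_ell:
  assumes adm: "admissible n c k r" and k: "k > 0" and w: "weight c + int k = int w"
    and i: "ell k < i" "i < rprime c r"
  shows "close w n (last (block c k r i)) (hd (block c k r (Suc i)))"
proof -
  define G where "G i = gen1_gray (add_entry c 1 i) (k - 1) i 0" for i
  note b = ell_bounds[OF k] and l = admissible_ell_le_rprime[OF adm k]
  have n: "length c = n" "r \<le> n"
    using adm by (auto simp: admissible_def subexcedant_def)
  have admG: "admissible n (add_entry c 1 i') (k - 1) i'" if "i' \<in> {i, Suc i}" for i'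
    using admissible_above_ell[OF adm k, of i'] that i by auto
  have G: "G i' \<noteq> []" "hd (G i') = shift c (\<lambda>j. packing (k - 1) j + (if j = i' then 1 else 0))"
    "set (G i') \<subseteq> S w n" if "i' \<in> {i, Suc i}" for i'
  proof -
    have i': "1 \<le> i'" "i' \<le> length c"
      using that i l n by auto
    show "G i' \<noteq> []"
      "hd (G i') = shift c (\<lambda>j. packing (k - 1) j + (if j = i' then 1 else 0))"
      unfolding G_def using gen1_gray_hd[OF admG[OF that]] i' by (simp_all add: shift_add_entry)
    show "set (G i') \<subseteq> S w n"
      unfolding G_def using gen1_gray_subset[OF admG[OF that], of w] i' w k
      by (simp add: weight_add_entry)
  qed
  have mem: "hd (G i') \<in> S w n" "last (G i') \<in> S w n" if "i' \<in> {i, Suc i}" for i'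
    using G[OF that] hd_in_set[of "G i'"] last_in_set[of "G i'"] by auto
  have blk: "block c k r i' = (if even (rprime c r - i') then rev (G i') else G i')"
    if "i' \<in> {i, Suc i}" for i'
    using that i by (auto simp: block_above G_def)
  have "Suc i \<le> length c" "3 \<le> Suc i"
    using i b l n by auto
  note p = this(2,1)
  show ?thesis
  proof (cases "even (rprime c r - i)")
    case True
    then have "odd (rprime c r - Suc i)"
      using i by (simp add: Suc_diff_Suc[symmetric] del: Suc_diff_Suc)
    then have *: "last (block c k r i) = hd (G i)" "hd (block c k r (Suc i)) = hd (G (Suc i))"
      using True i G(1) by (simp_all add: blk last_rev)
    show ?thesis
      unfolding * G(2)[of i, simplified] G(2)[of "Suc i", simplified]
      by (rule close_shift[where p = "Suc i" and ?a1.0 = 0 and ?a2.0 = 1 and ?a3.0 = "- 1"])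
        (use mem[of i] mem[of "Suc i"] G(2)[of i] G(2)[of "Suc i"] p i in
          \<open>auto simp: basic_differences_def\<close>)
  next
    case False
    then have "even (rprime c r - Suc i)"
      using i by (simp add: Suc_diff_Suc[symmetric] del: Suc_diff_Suc)
    then have *: "last (block c k r i) = last (G i)" "hd (block c k r (Suc i)) = last (G (Suc i))"
      using False i G(1) by (simp_all add: blk hd_rev)
    show ?thesis
    proof (cases "k = 1")
      case True
      have "last (G i') = shift c (\<lambda>j. if j = i' then 1 else 0)" if "i' \<in> {i, Suc i}" for i'
        using G(2)[OF that] True by (simp add: G_def)
      note last = this[of i, simplified] this[of "Suc i", simplified]
      show ?thesis
        unfolding * last
        by (rule close_shift[where p = "Suc i" and ?a1.0 = 0 and ?a2.0 = 1 and ?a3.0 = "- 1"])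
          (use mem[of i] mem[of "Suc i"] last p i in \<open>auto simp: basic_differences_def\<close>)
    next
      case False
      with k have k1: "k > 1"
        by simp
      \<comment> \<open>The last sequence for \<open>i\<close> has both extra units at
        \<open>i\<close>. The one for \<open>Suc i\<close> has one at \<open>Suc i\<close> and one
        at \<open>q\<close>, so one or two units move, according to whether \<open>q\<close> is
        \<open>i\<close> or \<open>Suc i\<close>.\<close>
      define q where "q = rprime (add_entry c 1 (Suc i)) (Suc i)"
      have q: "q = Suc i \<or> q = i"
        unfolding q_def using rprime_cases[of _ "Suc i"] by auto
      have lt: "ell (k - 1) < i" "ell (k - 1) < q"
        using ell_pred_le[of k] i q by auto
      have last: "last (G i) = shift c (\<lambda>j. packing (k - 1) j - (if j = ell (k - 1) then 1 else 0)
          + (if j = i then 1 else 0) + (if j = i then 1 else 0))"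
        "last (G (Suc i)) = shift c (\<lambda>j. packing (k - 1) j - (if j = ell (k - 1) then 1 else 0)
          + (if j = Suc i then 1 else 0) + (if j = q then 1 else 0))"
        unfolding G_def
        using gen1_gray_above_last[OF adm k1, of i] gen1_gray_above_last[OF adm k1, of "Suc i"]
          rprime_above_ell[OF adm k i] lt i by (simp_all add: q_def)
      show ?thesis
        unfolding * last
        by (rule close_shift[where p = "Suc i" and ?a1.0 = 0
              and ?a2.0 = "if q = i then 1 else 2" and ?a3.0 = "if q = i then - 1 else - 2"])
          (use mem(2)[of i] mem(2)[of "Suc i"] last p i q lt in
            \<open>auto simp: basic_differences_def\<close>)
    qed
  qed
qed

text \<open>The packing block ends with \<open>C\<close>, and the next block starts with the first
  or the last sequence of \<open>G\<close>, depending on parity. \<open>C\<close> is shown to be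
  close to both.\<close>

lemma close_ell:
  assumes adm: "admissible n c k r" and k: "k > 0" and w: "weight c + int k = int w"
    and l: "ell k < rprime c r"
  shows "close w n (last (block c k r (ell k))) (hd (block c k r (Suc (ell k))))"
proof -
  define l where "l = ell k"
  define e where "e = excess k"
  define G where "G = gen1_gray (add_entry c 1 (Suc l)) (k - 1) (Suc l) 0"
  define \<delta> :: "nat \<Rightarrow> nat \<Rightarrow> int" where "\<delta> i j = (if j = i then 1 else 0)" for i j
  note b = ell_bounds[OF k, folded l_def e_def]
  have lr: "l < rprime c r" "rprime c r \<le> r"
    using l admissible_ell_le_rprime[OF adm k] by (simp_all add: l_def)
  have n: "length c = n" "r \<le> n"
    using adm by (auto simp: admissible_def subexcedant_def)
  have entry_l: "entry c l = 0"
    using adm lr b by (simp add: admissible_def)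
  have admG: "admissible n (add_entry c 1 (Suc l)) (k - 1) (Suc l)"
    using admissible_above_ell[OF adm k, of "Suc l"] lr by (simp add: l_def)
  have packing_pred_l: "packing (k - 1) j = packing k j - \<delta> l j" for j
    using packing_pred[OF k] by (simp add: l_def \<delta>_def)
  define C where "C = last (block c k r l)"
  have C: "C = shift c (\<lambda>j. packing k j + (if e = l - 1 then 0 else \<delta> l j - \<delta> (l - 1) j))"
  proof -
    \<comment> \<open>As entry \<open>l\<close> of \<open>c\<close> is 0, the excess fills position
      \<open>l\<close> exactly when \<open>e = l - 1\<close>.\<close>
    have "int e = int l - 1 \<longleftrightarrow> e = l - 1"
      using b(1) by auto
    then show ?thesis
      using last_block_ell[OF adm k] entry_l unfolding C_def l_def e_def \<delta>_def by simp
  qed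
  have G: "G \<noteq> []" "hd G = shift c (\<lambda>j. packing k j - \<delta> l j + \<delta> (Suc l) j)"
    using gen1_gray_hd[OF admG] unfolding G_def packing_pred_l[abs_def]
    by (simp_all add: shift_add_entry packing_pred_l \<delta>_def cong: if_cong)
  have "set G \<subseteq> S w n"
    unfolding G_def using gen1_gray_subset[OF admG, of w] w k lr n
    by (simp add: weight_add_entry)
  then have memG: "hd G \<in> S w n" "last G \<in> S w n"
    using G(1) hd_in_set[of G] last_in_set[of G] by auto
  have memC: "C \<in> S w n"
  proof -
    have ne: "block c k r l \<noteq> []"
      using block_nonempty[OF adm k, of l] lr by (simp add: l_def)
    have "block c k r l =
        gen1_gray (add_entry c (int (excess k)) (ell k)) (k - excess k) (ell k) 0"
      by (simp add: block_def l_def)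
    also have "set \<dots> \<subseteq> S w n"
      using gen1_gray_subset[OF admissible_ell[OF adm k], of w] w b lr n
      by (simp add: weight_add_entry l_def e_def)
    finally show ?thesis
      using last_in_set[OF ne] unfolding C_def by blast
  qed
  have p: "3 \<le> Suc l" "Suc l \<le> length c"
    using b lr n by auto
  have blk: "block c k r (Suc l) = (if even (rprime c r - Suc l) then rev G else G)"
    by (simp add: block_above l_def G_def)
  have \<delta>_simps: "\<delta> i i = 1" "i \<noteq> j \<Longrightarrow> \<delta> i j = 0" for i j
    by (simp_all add: \<delta>_def)
  have "close w n C (hd G)"
    unfolding C G(2)
    by (rule close_shift[OF memC[unfolded C] memG(1)[unfolded G(2)] p,
          where ?a1.0 = "if e = l - 1 then 0 else - 1"
            and ?a2.0 = "if e = l - 1 then 1 else 2" and ?a3.0 = "- 1"])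
      (use b in \<open>simp_all add: \<delta>_simps basic_differences_def\<close>)
  moreover have "close w n C (last G)"
  proof (cases "k = 1")
    case True
    with G(1) have "last G = hd G"
      by (simp add: G_def)
    with \<open>close w n C (hd G)\<close> show ?thesis
      by simp
  next
    case False
    with k have k1: "k > 1"
      by simp
    define q where "q = rprime (add_entry c 1 (Suc l)) (Suc l)"
    have q: "q = Suc l \<or> q = l"
      unfolding q_def using rprime_cases[of _ "Suc l"] by auto
    have l3: "l \<ge> 3"
      using b(1) k1 ell_eq_2[OF k] by (auto simp: l_def le_less)
    define m where "m = ell (k - 1)"
    have m: "m = l \<and> e > 1 \<or> m = l - 1 \<and> e = 1"
      using ell_excess_pred[OF k1] b(3) unfolding m_def l_def e_def by linarith
    show ?thesis
    proof (cases "m < q")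
      case True
      \<comment> \<open>Relative to the packing of \<open>k\<close>, two units leave
        \<open>l\<close> and \<open>m\<close> and reappear at \<open>Suc l\<close> and
        \<open>q\<close>.\<close>
      then have last: "last G =
          shift c (\<lambda>j. packing k j - \<delta> l j - \<delta> m j + \<delta> (Suc l) j + \<delta> q j)"
        using gen1_gray_above_last[OF adm k1, of "Suc l"] lr
        unfolding packing_pred_l[abs_def] by (simp add: G_def m_def q_def l_def \<delta>_def)
      note mem = memC memG(2)
      \<comment> \<open>\<open>m = l - 1\<close> means \<open>e = 1\<close>, which differs from
        \<open>l - 1\<close> because \<open>l >= 3\<close>.\<close>
      consider "q = Suc l" "m = l" | "q = Suc l" "m = l - 1" "e \<noteq> l - 1"
        | "q = l" "m = l - 1" "e \<noteq> l - 1"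
        using m q True l3 by linarith
      then show ?thesis
      proof cases
        case 1
        show ?thesis
          unfolding C last
          by (rule close_shift[OF mem[unfolded C last] p,
                where ?a1.0 = "if e = l - 1 then 0 else - 1"
                  and ?a2.0 = "if e = l - 1 then 2 else 3" and ?a3.0 = "- 2"])
            (use l3 1 in \<open>simp_all add: \<delta>_simps basic_differences_def\<close>)
      next
        case 2
        show ?thesis
          unfolding C last
          by (rule close_shift[OF mem[unfolded C last] p,
                where ?a1.0 = 0 and ?a2.0 = 2 and ?a3.0 = "- 2"])
            (use l3 2 in \<open>simp_all add: \<delta>_simps basic_differences_def\<close>)
      next
        case 3
        show ?thesis
          unfolding C last
          by (rule close_shift[OF mem[unfolded C last] p,
                where ?a1.0 = 0 and ?a2.0 = 1 and ?a3.0 = "- 1"])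
            (use l3 3 in \<open>simp_all add: \<delta>_simps basic_differences_def\<close>)
      qed
    next
      case False
      with m q l3 have mq: "m = l" "q = l" "e > 1"
        by auto
      \<comment> \<open>Position \<open>Suc l\<close> is now full and the packing of
        \<open>k - 1\<close> still reaches \<open>l\<close>, so the inner list consists of its
        packing block alone.\<close>
      have "last G = last (block (add_entry c 1 (Suc l)) (k - 1) (Suc l) (ell (k - 1)))"
        using gen1_gray_last_block[OF admG] k1 mq by (simp add: G_def q_def m_def)
      also have "\<dots> = shift (add_entry c 1 (Suc l))
          (\<lambda>j. packing (k - 1) j + (\<delta> l j - \<delta> (l - 1) j))"
      proof -
        have "entry (add_entry c 1 (Suc l)) l = 0"
          using entry_l b p by (simp add: entry_add_entry)
        moreover have "excess (k - 1) = e - 1"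
          using ell_excess_pred(1)[OF k1] mq by (simp add: e_def)
        \<comment> \<open>The reduced excess leaves room at \<open>l\<close>, so the inner list ends
          with a unit moved from \<open>l - 1\<close> to \<open>l\<close>; this restores the unit
          lost at \<open>l\<close>.\<close>
        moreover have "int (e - 1) \<noteq> int l - 1"
          using b mq by linarith
        ultimately show ?thesis
          using last_block_ell[OF admG] k1 mq by (simp add: m_def \<delta>_def cong: if_cong)
      qed
      also have "\<dots> = shift c (\<lambda>j. packing k j - \<delta> (l - 1) j + \<delta> (Suc l) j)"
        unfolding packing_pred_l by (simp add: shift_add_entry \<delta>_def algebra_simps cong: if_cong)
      finally have last: "last G = shift c (\<lambda>j. packing k j - \<delta> (l - 1) j + \<delta> (Suc l) j)" .
      show ?thesis
        unfolding C last
        by (rule close_shift[OF memC[unfolded C] memG(2)[unfolded last] p,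
              where ?a1.0 = "if e = l - 1 then 1 else 0"
                and ?a2.0 = "if e = l - 1 then 0 else 1" and ?a3.0 = "- 1"])
          (use l3 in \<open>simp_all add: \<delta>_simps basic_differences_def\<close>)
    qed
  qed
  ultimately show ?thesis
    using G(1) unfolding C_def[symmetric] l_def[symmetric] blk by (simp add: hd_rev)
qed

section \<open>Assembling blocks and junctions\<close>

lemma successively_concat_upt:
  assumes "\<And>i. a \<le> i \<Longrightarrow> i < b \<Longrightarrow> f i \<noteq> [] \<and> successively P (f i)"
    and "\<And>i. a \<le> i \<Longrightarrow> Suc i < b \<Longrightarrow> P (last (f i)) (hd (f (Suc i)))"
  shows "successively P (concat (map f [a..<b]))"
  using assms
proof (induction b)
  case (Suc b)
  show ?case
  proof (cases "a < b")
    case True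
    then obtain b' where b': "b = Suc b'" "a \<le> b'"
      by (cases b) auto
    \<comment> \<open>Nonempty blocks ensure that the concatenation ends with the last element of
      the preceding block.\<close>
    have "last (concat (map f [a..<b])) = last (f b')"
      using Suc.prems(1)[of b'] b' by simp
    then show ?thesis
      using Suc b' True by (simp add: successively_append_iff del: upt_Suc add: upt_Suc_append)
  next
    case False
    then show ?thesis
      using Suc.prems(1)[of b] by simp
  qed
qed simp

text \<open>Inside a block the induction hypothesis applies, with symmetry of closeness for reversed
  blocks; between blocks the junction lemmas apply.\<close>

lemma gen1_gray_successively_close:
  assumes "admissible n c k r" "weight c + int k = int w"
  shows "successively (close w n) (gen1_gray c k r 0)"
  using assms
proof (induction k arbitrary: c r rule: less_induct)
  case (less k)
  show ?case
  proof (cases "k = 0")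
    case False
    then have k: "k > 0"
      by simp
    note adm = less.prems(1) and w = less.prems(2)
    note l = admissible_ell_le_rprime[OF adm k] and b = ell_bounds[OF k]
    have n: "length c = n" "r \<le> n"
      using adm by (auto simp: admissible_def subexcedant_def)
    have blocks: "successively (close w n) (block c k r i)"
      if i: "ell k \<le> i" "i \<le> rprime c r" for i
    proof (cases "i = ell k")
      case True
      have "successively (close w n)
          (gen1_gray (add_entry c (int (excess k)) (ell k)) (k - excess k) (ell k) 0)"
        using k b l n w by (intro less.IH admissible_ell[OF adm k]) (auto simp: weight_add_entry)
      with True show ?thesis
        by (simp add: block_def)
    next
      case False
      have "successively (close w n) (gen1_gray (add_entry c 1 i) (k - 1) i 0)" (is "successively _ ?g")
        using k b l n w i False
        by (intro less.IH admissible_above_ell[OF adm k]) (auto simp: weight_add_entry)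
      moreover from this have "successively (close w n) (rev ?g)"
        unfolding successively_rev by (rule successively_mono) (auto intro: close_sym)
      ultimately show ?thesis
        using False i by (simp add: block_above)
    qed
    have junctions: "close w n (last (block c k r i)) (hd (block c k r (Suc i)))"
      if "ell k \<le> i" "Suc i < Suc (rprime c r)" for i
      using that close_ell[OF adm k w] close_above_ell[OF adm k w, of i]
      by (cases "i = ell k") auto
    show ?thesis
      unfolding gen1_gray_direction_0[OF k l(1)]
      using blocks block_nonempty[OF adm k] junctions
      by (intro successively_concat_upt) auto
  qed simp
qed

theorem theorem4:
  fixes n k :: nat
  assumes "n \<ge> 1" and "k \<le> n * (n - 1) div 2"
  shows "successively (close k n) (gray_list k n)"
proof -
  \<comment> \<open>For the zero sequence the invariant reduces to \<open>k <= tri n\<close>, the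
    bound assumed on \<open>k\<close>.\<close>
  have "admissible n (replicate n 0) k n"
    using assms by (auto simp: admissible_def subexcedant_def entry_def tri_def)
  then show ?thesis
    unfolding gray_list_def
    by (rule gen1_gray_successively_close) (simp add: weight_def sum_list_replicate)
qed

end
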